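(* For $k=-1,0,1,2,\dots$, \[ (D_x+D_y+k)F_{k+1} = (D_xD_y- D_x-D_y+1-k)F_k + \sum_{l=0}^{k+1} D_x F_l \cdot D_y F_{k+1-l}, \] where $D_x = x \partial_x$ and $D_y = y \partial_y$.
   Context: For integers $r,s\ge 0$ and $k$, $N_{\rm bi}(r,s,k)$ is the number of connected bipartite simple graphs with labeled bipartition $V_1\sqcup V_2$, $|V_1|=r$, $|V_2|=s$, having exactly $r+s+k-1$ edges; equivalently, the number of connected spanning subgraphs of the complete bipartite graph $K_{r,s}$ with $r+s+k-1$ edges. In particular $N_{\rm bi}(r,s,k)=0$ if $k<0$ or $r+s+k-1>rs$, with the following conventions: if $rs=0$, then $N_{\rm bi}(r,s,k)=1$ if $k=0$ and $(r,s)\in\{(1,0),(0,1)\}$, and $0$ otherwise. For $k\ge 0$ let $F_k(x,y) = \sum_{r,s=0}^{\infty} \frac{N_{\rm bi}(r,s,k)}{r!s!}x^r y^s$ (formal power series), and let $F_{-1}:=0$. *)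

theory Defs
  imports
    "HOL-Computational_Algebra.Formal_Power_Series"
    "Graph_Theory.Digraph_Component"
begin

text \<open>
  Simple graphs are the \<open>pair_graph\<close>s of the AFP entry: finite, loop-free, symmetric
  digraphs without parallel arcs. Each undirected edge \<open>{u, v}\<close> is thus a pair of
  opposite arcs, and the number of edges is the number of unordered pairs below, not
  the number of arcs.
\<close>

definition edges :: "'a pair_pre_digraph \<Rightarrow> 'a set set" where
  "edges G = {{u, v} | u v. (u, v) \<in> parcs G}"

definition left_part :: "nat \<Rightarrow> (nat + nat) set" where
  "left_part r = Inl ` {..<r}"

definition right_part :: "nat \<Rightarrow> (nat + nat) set" where
  "right_part s = Inr ` {..<s}"

text \<open>
  The constant \<open>Digraph_Component.connected\<close> is graph connectedness (of a graph with at least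
  one vertex); it shares its base name with topological connectedness.
\<close>

definition connected_bipartite_graphs :: "nat \<Rightarrow> nat \<Rightarrow> (nat + nat) pair_pre_digraph set" where
  "connected_bipartite_graphs r s =
    {G. pair_graph G \<and>
        pverts G = left_part r \<union> right_part s \<and>
        parcs G \<subseteq> left_part r \<times> right_part s \<union> right_part s \<times> left_part r \<and>
        Digraph_Component.connected (with_proj G)}"

definition N_bi :: "nat \<Rightarrow> nat \<Rightarrow> int \<Rightarrow> nat" where
  "N_bi r s k =
    (if r * s = 0 then (if k = 0 \<and> (r, s) \<in> {(1, 0), (0, 1)} then 1 else 0)
     else card {G \<in> connected_bipartite_graphs r s.
                  int (card (edges G)) = int r + int s + k - 1})"

text \<open>
  A bivariate power series is a series in \<open>x\<close> whose coefficients are series in \<open>y\<close>: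
  the coefficient of \<open>x\<^sup>r y\<^sup>s\<close> in \<open>f\<close> is \<open>fps_nth (fps_nth f r) s\<close>.
\<close>

definition F :: "int \<Rightarrow> rat fps fps" where
  "F k = (if k < 0 then 0
          else Abs_fps (\<lambda>r. Abs_fps (\<lambda>s. of_nat (N_bi r s k) / (fact r * fact s))))"

definition D_x :: "'a::comm_ring_1 fps fps \<Rightarrow> 'a fps fps" where
  "D_x f = fps_X * fps_deriv f"

definition D_y :: "'a::comm_ring_1 fps fps \<Rightarrow> 'a fps fps" where
  "D_y f = Abs_fps (\<lambda>r. fps_X * fps_deriv (fps_nth f r))"

end

theory Submission
  imports Defs
begin

text \<open>
  Count pairs of a connected bipartite graph with \<open>r + s + k\<close> edges and one of its edges \<open>e\<close>.
  Deleting \<open>e\<close> leaves either a connected graph with one edge less, to which \<open>e\<close> can be any of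
  the missing edges, or two connected graphs with excesses \<open>l\<close> and \<open>k + 1 - l\<close>, the first
  containing the left and the second the right endpoint of \<open>e\<close>. Dividing by \<open>r! s!\<close> turns
  the resulting recursion into the differential equation, coefficient by coefficient.

  Connectedness is handled through cuts instead of paths: no nontrivial set of vertices
  is a union of components.
\<close>

subsection \<open>Connectedness by cuts\<close>

text \<open>No edge leaves \<open>(X, Y)\<close>, so it is a union of components. An edge is stored
  once, left endpoint first, so \<open>card E\<close> counts undirected edges.\<close>

definition saturated :: "('a \<times> 'b) set \<Rightarrow> 'a set \<Rightarrow> 'b set \<Rightarrow> bool" where
  "saturated E X Y \<longleftrightarrow> (\<forall>a b. (a, b) \<in> E \<longrightarrow> (a \<in> X \<longleftrightarrow> b \<in> Y))"

text \<open>The first clause rules out the graph without vertices, as the counting convention for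
  \<open>r = s = 0\<close> demands; a single vertex on either side is connected.\<close>

definition bip_connected :: "'a set \<Rightarrow> 'b set \<Rightarrow> ('a \<times> 'b) set \<Rightarrow> bool" where
  "bip_connected A B E \<longleftrightarrow> (A \<noteq> {} \<or> B \<noteq> {}) \<and>
    (\<forall>X Y. X \<subseteq> A \<and> Y \<subseteq> B \<and> saturated E X Y \<longrightarrow> X = {} \<and> Y = {} \<or> X = A \<and> Y = B)"

lemma bip_connectedD:
  assumes "bip_connected A B E" "X \<subseteq> A" "Y \<subseteq> B" "saturated E X Y"
  shows "X = {} \<and> Y = {} \<or> X = A \<and> Y = B"
  using assms unfolding bip_connected_def by blast

section \<open>Joining and splitting at a bridge\<close>

text \<open>A cut of the joined graph restricts to a trivial cut on each of the two pieces, and the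
  edge from \<open>a\<close> to \<open>b\<close> forces both pieces onto the same side.\<close>

lemma bip_connected_join:
  assumes "X \<subseteq> A" "Y \<subseteq> B" "a \<in> X" "b \<in> B - Y"
    and E1: "E1 \<subseteq> X \<times> Y" and E2: "E2 \<subseteq> (A - X) \<times> (B - Y)"
    and c1: "bip_connected X Y E1" and c2: "bip_connected (A - X) (B - Y) E2"
  shows "bip_connected A B (insert (a, b) (E1 \<union> E2))"
  unfolding bip_connected_def
proof (intro conjI allI impI)
  show "A \<noteq> {} \<or> B \<noteq> {}" using assms by auto
  fix P Q assume *: "P \<subseteq> A \<and> Q \<subseteq> B \<and> saturated (insert (a, b) (E1 \<union> E2)) P Q"
  then have ab: "a \<in> P \<longleftrightarrow> b \<in> Q" by (simp add: saturated_def)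
  have "saturated E1 (P \<inter> X) (Q \<inter> Y)" "saturated E2 (P - X) (Q - Y)"
    using * E1 E2 by (auto simp: saturated_def)
  moreover have "P - X \<subseteq> A - X" "Q - Y \<subseteq> B - Y" using * by auto
  ultimately have d1: "P \<inter> X = {} \<and> Q \<inter> Y = {} \<or> P \<inter> X = X \<and> Q \<inter> Y = Y"
    and d2: "P - X = {} \<and> Q - Y = {} \<or> P - X = A - X \<and> Q - Y = B - Y"
    by (intro bip_connectedD[OF c1] bip_connectedD[OF c2]; simp)+
  show "P = {} \<and> Q = {} \<or> P = A \<and> Q = B"
  proof (cases "a \<in> P")
    case True
    then have "X \<subseteq> P" "Y \<subseteq> Q" using d1 assms(3) by blast+
    moreover have "A - X \<subseteq> P" "B - Y \<subseteq> Q" using d2 True ab assms(4) by blast+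
    ultimately show ?thesis using * by blast
  next
    case False
    then have "P \<inter> X = {}" "Q \<inter> Y = {}" using d1 assms(3) by blast+
    moreover have "P - X = {}" "Q - Y = {}" using d2 False ab assms(4) by blast+
    ultimately show ?thesis by blast
  qed
qed

text \<open>A nontrivial cut that appears on deleting the edge must separate \<open>a\<close> from
  \<open>b\<close>. Each of its sides is connected, because a finer cut could be chosen away from
  the endpoints of the deleted edge and would then already cut the connected graph
  \<open>E\<close>.\<close>

lemma bip_connected_split:
  assumes E: "E \<subseteq> A \<times> B" and c: "bip_connected A B E" and ab: "(a, b) \<in> E"
    and nc: "\<not> bip_connected A B (E - {(a, b)})"
  obtains X Y where "X \<subseteq> A" "Y \<subseteq> B" "a \<in> X" "b \<in> B - Y"
    "bip_connected X Y (E \<inter> X \<times> Y)"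
    "bip_connected (A - X) (B - Y) (E \<inter> (A - X) \<times> (B - Y))"
    "E - {(a, b)} = E \<inter> X \<times> Y \<union> E \<inter> (A - X) \<times> (B - Y)"
proof -
  have aA: "a \<in> A" and bB: "b \<in> B" using E ab by auto
  obtain P Q where PQ: "P \<subseteq> A" "Q \<subseteq> B" "saturated (E - {(a, b)}) P Q"
    "\<not> (P = {} \<and> Q = {})" "\<not> (P = A \<and> Q = B)"
    using nc aA unfolding bip_connected_def by blast
  \<comment> \<open>The complement of a cut is again a cut, so the side containing \<open>a\<close>
    may be chosen.\<close>
  obtain X Y where XY: "X \<subseteq> A" "Y \<subseteq> B" "saturated (E - {(a, b)}) X Y"
    "\<not> (X = {} \<and> Y = {})" "\<not> (X = A \<and> Y = B)" "a \<in> X"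
  proof (cases "a \<in> P")
    case True then show ?thesis using PQ that by blast
  next
    case False
    have "saturated (E - {(a, b)}) (A - P) (B - Q)"
      using PQ(3) E by (auto simp: saturated_def)
    moreover have "\<not> (A - P = {} \<and> B - Q = {})" "\<not> (A - P = A \<and> B - Q = B)"
      using PQ by blast+
    ultimately show ?thesis using that[of "A - P" "B - Q"] False aA by blast
  qed
  have bY: "b \<notin> Y"
  proof
    assume "b \<in> Y"
    then have "saturated E X Y" using XY(3,6) by (auto simp: saturated_def)
    then show False using bip_connectedD[OF c XY(1,2)] XY by blast
  qed
  have "bip_connected X Y (E \<inter> X \<times> Y)"
    unfolding bip_connected_def
  proof (intro conjI allI impI)
    show "X \<noteq> {} \<or> Y \<noteq> {}" using XY by blast
    fix P Q assume *: "P \<subseteq> X \<and> Q \<subseteq> Y \<and> saturated (E \<inter> X \<times> Y) P Q"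
    \<comment> \<open>Of the cut and its complement inside \<open>(X, Y)\<close>, take the one
      avoiding \<open>a\<close>. It misses both endpoints of the deleted edge, hence is saturated in
      all of \<open>E\<close>; connectedness of \<open>E\<close> leaves only the empty cut, since
      \<open>a\<close> is missed.\<close>
    define P' where "P' = (if a \<in> P then X - P else P)"
    define Q' where "Q' = (if a \<in> P then Y - Q else Q)"
    have sub: "P' \<subseteq> X" "Q' \<subseteq> Y" "a \<notin> P'" "b \<notin> Q'"
      using * bY XY by (auto simp: P'_def Q'_def)
    have "saturated (E \<inter> X \<times> Y) P' Q'"
      using * by (auto simp: P'_def Q'_def saturated_def)
    then have "saturated E P' Q'"
      using XY(3) sub unfolding saturated_def by blast
    then have "P' = {} \<and> Q' = {} \<or> P' = A \<and> Q' = B"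
      using bip_connectedD[OF c] sub XY by (meson order_trans)
    then have "P' = {} \<and> Q' = {}" using sub aA by blast
    then show "P = {} \<and> Q = {} \<or> P = X \<and> Q = Y"
      using * by (auto simp: P'_def Q'_def split: if_splits)
  qed
  moreover have "bip_connected (A - X) (B - Y) (E \<inter> (A - X) \<times> (B - Y))"
    unfolding bip_connected_def
  proof (intro conjI allI impI)
    show "A - X \<noteq> {} \<or> B - Y \<noteq> {}" using bB bY by blast
    fix P Q assume *: "P \<subseteq> A - X \<and> Q \<subseteq> B - Y \<and> saturated (E \<inter> (A - X) \<times> (B - Y)) P Q"
    \<comment> \<open>The mirror image: now \<open>b\<close> is the endpoint to avoid, while
      \<open>a\<close> lies in \<open>X\<close> and so on the other side.\<close>
    define P' where "P' = (if b \<in> Q then (A - X) - P else P)"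
    define Q' where "Q' = (if b \<in> Q then (B - Y) - Q else Q)"
    have sub: "P' \<subseteq> A - X" "Q' \<subseteq> B - Y" "a \<notin> P'" "b \<notin> Q'"
      using * bY XY by (auto simp: P'_def Q'_def)
    have "saturated (E \<inter> (A - X) \<times> (B - Y)) P' Q'"
      using * by (auto simp: P'_def Q'_def saturated_def)
    then have "saturated E P' Q'"
      using XY(3) sub E unfolding saturated_def by blast
    then have "P' = {} \<and> Q' = {} \<or> P' = A \<and> Q' = B"
      using bip_connectedD[OF c, of P' Q'] sub by blast
    then have "P' = {} \<and> Q' = {}" using sub aA by blast
    then show "P = {} \<and> Q = {} \<or> P = A - X \<and> Q = B - Y"
      using * by (auto simp: P'_def Q'_def split: if_splits)
  qed
  moreover have "E - {(a, b)} = E \<inter> X \<times> Y \<union> E \<inter> (A - X) \<times> (B - Y)"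
    using XY(3,6) E bY by (auto simp: saturated_def)
  ultimately show ?thesis using that XY bY bB by blast
qed

section \<open>Lower bound for the number of edges\<close>

lemma bip_connected_empty_edges:
  assumes "finite A" "finite B" "bip_connected A B {}"
  shows "card A + card B = 1"
proof (cases "A = {}")
  case True
  then obtain b where "b \<in> B" using assms by (auto simp: bip_connected_def)
  then have "B = {b}"
    using bip_connectedD[OF assms(3), of "{}" "{b}"] by (auto simp: saturated_def)
  then show ?thesis using True by simp
next
  case False
  then obtain a where "a \<in> A" by auto
  then have "A = {a} \<and> B = {}"
    using bip_connectedD[OF assms(3), of "{a}" "{}"] by (auto simp: saturated_def)
  then show ?thesis by simp
qed

text \<open>Delete an edge and induct. If the rest is disconnected, the bounds for the two pieces
  add up, and the deleted edge makes up for the second \<open>+ 1\<close>. In terms of excesses: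
  they are never negative.\<close>

lemma card_vertices_le_edges:
  assumes "finite A" "finite B" "E \<subseteq> A \<times> B" "bip_connected A B E"
  shows "card A + card B \<le> card E + 1"
  using assms
proof (induction "card E" arbitrary: A B E rule: less_induct)
  case less
  have fE: "finite E" using less.prems finite_subset by blast
  show ?case
  proof (cases "E = {}")
    case True
    then show ?thesis using bip_connected_empty_edges less.prems by fastforce
  next
    case False
    then obtain a b where ab: "(a, b) \<in> E" by auto
    have cE: "card E = Suc (card (E - {(a, b)}))" using ab fE by (metis card.remove)
    show ?thesis
    proof (cases "bip_connected A B (E - {(a, b)})")
      case True
      then show ?thesis using less.hyps[of "E - {(a, b)}" A B] less.prems cE by fastforce
    next
      case False
      obtain X Y where XY: "X \<subseteq> A" "Y \<subseteq> B"
        "bip_connected X Y (E \<inter> X \<times> Y)"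
        "bip_connected (A - X) (B - Y) (E \<inter> (A - X) \<times> (B - Y))"
        "E - {(a, b)} = E \<inter> X \<times> Y \<union> E \<inter> (A - X) \<times> (B - Y)"
        using bip_connected_split[OF less.prems(3,4) ab False] by metis
      have c: "card (E - {(a, b)}) = card (E \<inter> X \<times> Y) + card (E \<inter> (A - X) \<times> (B - Y))"
        unfolding XY(5) using fE by (intro card_Un_disjoint) auto
      have "card X + card Y \<le> card (E \<inter> X \<times> Y) + 1"
        using less.prems XY c cE by (intro less.hyps) (auto intro: finite_subset)
      moreover have "card (A - X) + card (B - Y) \<le> card (E \<inter> (A - X) \<times> (B - Y)) + 1"
        using less.prems XY c cE by (intro less.hyps) auto
      moreover have "card A = card X + card (A - X)" "card B = card Y + card (B - Y)"
        using less.prems(1,2) XY(1,2)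
        by (metis card_Diff_subset card_mono finite_subset le_add_diff_inverse)+
      ultimately show ?thesis using c cE by linarith
    qed
  qed
qed

subsection \<open>The edge-deletion recursion\<close>

text \<open>Here \<open>k\<close> is the excess, as in \<open>N_bi r s k\<close>.\<close>

definition bip_graphs :: "'a set \<Rightarrow> 'b set \<Rightarrow> int \<Rightarrow> ('a \<times> 'b) set set" where
  "bip_graphs A B k =
    {E. E \<subseteq> A \<times> B \<and> bip_connected A B E \<and> int (card E) = int (card A) + int (card B) + k - 1}"

lemma finite_bip_graphs: "finite A \<Longrightarrow> finite B \<Longrightarrow> finite (bip_graphs A B k)"
  by (rule finite_subset[of _ "Pow (A \<times> B)"]) (auto simp: bip_graphs_def)

lemma bip_graphs_negative:
  assumes "finite A" "finite B" "k < 0"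
  shows "bip_graphs A B k = {}"
proof -
  have False if "E \<in> bip_graphs A B k" for E
    using card_vertices_le_edges[OF assms(1,2), of E] assms(3) that by (simp add: bip_graphs_def)
  then show ?thesis by blast
qed

text \<open>No edge of the common union leaves \<open>(X', Y')\<close>, so this set cuts the
  connected piece \<open>(X, Y)\<close> trivially, and both contain \<open>a\<close>. Used in both
  directions, it shows that the component of \<open>a\<close> is determined by the graph that
  remains after deleting a bridge.\<close>

lemma bip_join_component_unique:
  assumes "X \<subseteq> A" "Y \<subseteq> B" "X' \<subseteq> A" "Y' \<subseteq> B" "a \<in> X" "a \<in> X'"
    and "E1 \<subseteq> X \<times> Y" "E2 \<subseteq> (A - X) \<times> (B - Y)" "E1' \<subseteq> X' \<times> Y'" "E2' \<subseteq> (A - X') \<times> (B - Y')"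
    and c: "bip_connected X Y E1" and eq: "E1 \<union> E2 = E1' \<union> E2'"
  shows "X \<subseteq> X' \<and> Y \<subseteq> Y'"
proof -
  have "saturated (E1' \<union> E2') X' Y'" using assms by (auto simp: saturated_def)
  then have "saturated E1 X' Y'" using eq by (auto simp: saturated_def)
  then have "saturated E1 (X \<inter> X') (Y \<inter> Y')"
    using assms(7) by (auto simp: saturated_def)
  then show ?thesis using bip_connectedD[OF c, of "X \<inter> X'" "Y \<inter> Y'"] assms(5,6) by auto
qed

lemma int_card_SIGMA:
  assumes "finite A" "\<And>x. x \<in> A \<Longrightarrow> finite (B x)" "\<And>x. x \<in> A \<Longrightarrow> int (card (B x)) = c"
  shows "int (card (Sigma A B)) = c * int (card A)"
  using assms by (simp add: card_SigmaI)

section \<open>Pairs of a graph and one of its edges\<close>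

text \<open>Deleting \<open>e\<close> is a bijection onto the pairs of a connected graph of excess
  \<open>k\<close> and a missing edge; the first factor on the right is the number of missing edges
  of each such graph.\<close>

lemma bip_graphs_removable_edges:
  assumes "finite A" "finite B"
  shows "int (card {(E, e). E \<in> bip_graphs A B (k + 1) \<and> e \<in> E \<and> bip_connected A B (E - {e})}) =
    (int (card A) * int (card B) - (int (card A) + int (card B) + k - 1)) * int (card (bip_graphs A B k))"
proof -
  have fin: "finite E" if "E \<subseteq> A \<times> B" for E using assms that finite_subset by blast
  define T where "T = (SIGMA E:bip_graphs A B k. A \<times> B - E)"
  define L where "L = {(E, e). E \<in> bip_graphs A B (k + 1) \<and> e \<in> E \<and> bip_connected A B (E - {e})}"
  have "bij_betw (\<lambda>(E, e). (insert e E, e)) T L"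
  proof (rule bij_betw_byWitness[where f' = "\<lambda>(E, e). (E - {e}, e)"])
    show "(\<lambda>(E, e). (insert e E, e)) ` T \<subseteq> L"
    proof clarsimp
      fix E a b assume "(E, a, b) \<in> T"
      then have E: "E \<in> bip_graphs A B k" and ab: "a \<in> A" "b \<in> B" "(a, b) \<notin> E"
        by (auto simp: T_def)
      then have "bip_connected A B E" "E \<subseteq> A \<times> B" by (auto simp: bip_graphs_def)
      \<comment> \<open>An additional edge can only reduce the number of saturated pairs.\<close>
      moreover have "bip_connected A B (insert (a, b) E)"
        using \<open>bip_connected A B E\<close> by (auto simp: bip_connected_def saturated_def)
      ultimately show "(insert (a, b) E, a, b) \<in> L"
        using E ab fin[of E] by (auto simp: L_def bip_graphs_def)
    qed
    show "(\<lambda>(E, e). (E - {e}, e)) ` L \<subseteq> T"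
    proof clarsimp
      fix E a b assume "(E, a, b) \<in> L"
      then have E: "E \<subseteq> A \<times> B" "(a, b) \<in> E" "bip_connected A B (E - {(a, b)})"
        "int (card E) = int (card A) + int (card B) + k"
        by (auto simp: L_def bip_graphs_def)
      have "int (card (E - {(a, b)})) = int (card A) + int (card B) + k - 1"
        using card.remove[OF fin[OF E(1)] E(2)] E(4) by linarith
      then show "(E - {(a, b)}, a, b) \<in> T"
        using E(1-3) unfolding T_def bip_graphs_def by blast
    qed
  qed (auto simp: T_def L_def)
  then have "card L = card T" by (rule bij_betw_same_card[symmetric])
  moreover have "int (card T) =
    (int (card A) * int (card B) - (int (card A) + int (card B) + k - 1)) * int (card (bip_graphs A B k))"
    unfolding T_def
  proof (rule int_card_SIGMA)
    fix E assume "E \<in> bip_graphs A B k"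
    then have E: "E \<subseteq> A \<times> B" "int (card E) = int (card A) + int (card B) + k - 1"
      by (auto simp: bip_graphs_def)
    have "card E \<le> card (A \<times> B)" using E assms by (intro card_mono) auto
    then show "int (card (A \<times> B - E)) =
        int (card A) * int (card B) - (int (card A) + int (card B) + k - 1)"
      using E assms fin by (simp add: card_Diff_subset of_nat_diff card_cartesian_product)
  qed (use assms finite_bip_graphs in auto)
  ultimately show ?thesis unfolding L_def by simp
qed

text \<open>A graph with a marked bridge \<open>(a, b)\<close> corresponds to the component
  \<open>(X, Y)\<close> of \<open>a\<close> after deletion, its excess \<open>l\<close>, the two
  pieces and the two endpoints. The sides of the endpoints order the two pieces, so nothing is
  counted twice.\<close>

lemma bip_graphs_bridges:
  assumes "finite A" "finite B"
  shows "card {(E, e). E \<in> bip_graphs A B (k + 1) \<and> e \<in> E \<and> \<not> bip_connected A B (E - {e})} =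
    (\<Sum>X\<in>Pow A. \<Sum>Y\<in>Pow B. \<Sum>l=0..k + 1. card (bip_graphs X Y l) *
      card (bip_graphs (A - X) (B - Y) (k + 1 - l)) * (card X * card (B - Y)))"
proof -
  have fin: "finite E" if "E \<subseteq> A \<times> B" for E using assms that finite_subset by blast
  define L where "L = {(E, e). E \<in> bip_graphs A B (k + 1) \<and> e \<in> E \<and> \<not> bip_connected A B (E - {e})}"
  define T where "T = (SIGMA (X, Y, l) : Pow A \<times> Pow B \<times> {0..k + 1}.
    (bip_graphs X Y l \<times> bip_graphs (A - X) (B - Y) (k + 1 - l)) \<times> (X \<times> (B - Y)))"
  define f :: "('a set \<times> 'b set \<times> int) \<times> (('a \<times> 'b) set \<times> ('a \<times> 'b) set) \<times> ('a \<times> 'b) \<Rightarrow> _"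
    where "f = (\<lambda>(_, (E1, E2), e). (insert e (E1 \<union> E2), e))"
  have cards: "card A = card X + card (A - X)" "card B = card Y + card (B - Y)"
    if "X \<subseteq> A" "Y \<subseteq> B" for X Y using assms that
    by (metis card_Diff_subset card_mono finite_subset le_add_diff_inverse)+
  have "bij_betw f T L"
    unfolding bij_betw_def
  proof
    show "inj_on f T"
    proof (rule inj_onI)
      fix p q assume p: "p \<in> T" and q: "q \<in> T" and eq: "f p = f q"
      obtain X Y l E1 E2 a b where pe: "p = ((X, Y, l), (E1, E2), (a, b))" by (metis surj_pair)
      obtain X' Y' l' E1' E2' a' b' where qe: "q = ((X', Y', l'), (E1', E2'), (a', b'))"
        by (metis surj_pair)
      have ab: "a' = a" "b' = b" using eq by (auto simp: pe qe f_def)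
      have P: "X \<subseteq> A" "Y \<subseteq> B" "a \<in> X" "b \<in> B - Y" "E1 \<subseteq> X \<times> Y" "E2 \<subseteq> (A - X) \<times> (B - Y)"
        "bip_connected X Y E1" "int (card E1) = int (card X) + int (card Y) + l - 1"
        using p by (auto simp: pe T_def bip_graphs_def)
      have Q: "X' \<subseteq> A" "Y' \<subseteq> B" "a \<in> X'" "b \<in> B - Y'" "E1' \<subseteq> X' \<times> Y'"
        "E2' \<subseteq> (A - X') \<times> (B - Y')"
        "bip_connected X' Y' E1'" "int (card E1') = int (card X') + int (card Y') + l' - 1"
        using q by (auto simp: qe ab T_def bip_graphs_def)
      \<comment> \<open>The bridge runs from \<open>X\<close> to \<open>B - Y\<close> and so lies in
        neither piece; it can be cancelled from both sides of the equation.\<close>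
      have "(a, b) \<notin> E1 \<union> E2" "(a, b) \<notin> E1' \<union> E2'" using P Q by auto
      moreover have "insert (a, b) (E1 \<union> E2) = insert (a, b) (E1' \<union> E2')"
        using eq by (simp add: pe qe f_def ab)
      ultimately have un: "E1 \<union> E2 = E1' \<union> E2'" by (simp add: insert_ident)
      have "X \<subseteq> X' \<and> Y \<subseteq> Y'"
        by (rule bip_join_component_unique[OF P(1,2) Q(1,2) P(3) Q(3) P(5,6) Q(5,6) P(7) un])
      moreover have "X' \<subseteq> X \<and> Y' \<subseteq> Y"
        by (rule bip_join_component_unique[OF Q(1,2) P(1,2) Q(3) P(3) Q(5,6) P(5,6) Q(7) un[symmetric]])
      ultimately have XY: "X' = X" "Y' = Y" by auto
      have "E1 = (E1 \<union> E2) \<inter> X \<times> Y" "E1' = (E1' \<union> E2') \<inter> X \<times> Y"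
        "E2 = (E1 \<union> E2) - X \<times> Y" "E2' = (E1' \<union> E2') - X \<times> Y"
        using P(5,6) Q(5,6) XY by auto
      then have "E1' = E1" "E2' = E2" using un by metis+
      moreover from this have "l' = l" using P(8) Q(8) XY by simp
      ultimately show "p = q" by (simp add: pe qe ab XY)
    qed
    show "f ` T = L"
    proof (intro equalityI subsetI)
      fix z assume "z \<in> f ` T"
      then obtain X Y l E1 E2 a b where p: "((X, Y, l), (E1, E2), (a, b)) \<in> T"
        and z: "z = f ((X, Y, l), (E1, E2), (a, b))" by (metis (no_types, lifting) imageE surj_pair)
      have P: "X \<subseteq> A" "Y \<subseteq> B" "a \<in> X" "b \<in> B - Y" "E1 \<subseteq> X \<times> Y" "E2 \<subseteq> (A - X) \<times> (B - Y)"
        "bip_connected X Y E1" "bip_connected (A - X) (B - Y) E2"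
        "int (card E1) = int (card X) + int (card Y) + l - 1"
        "int (card E2) = int (card (A - X)) + int (card (B - Y)) + (k + 1 - l) - 1"
        using p by (auto simp: T_def bip_graphs_def)
      have ab: "(a, b) \<notin> E1 \<union> E2" using P by auto
      have sub: "E1 \<union> E2 \<subseteq> A \<times> B" using P by auto
      have "card (E1 \<union> E2) = card E1 + card E2"
        using sub P(5,6) by (intro card_Un_disjoint fin) auto
      \<comment> \<open>Excesses \<open>l\<close> and \<open>k + 1 - l\<close> leave the union one
        edge short of what excess \<open>k + 1\<close> requires, since each piece contributes a
        \<open>- 1\<close>; the bridge supplies that edge.\<close>
      then have "int (card (insert (a, b) (E1 \<union> E2))) = int (card A) + int (card B) + (k + 1) - 1"
        using ab fin[OF sub] P(9,10) cards[OF P(1,2)] by simp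
      then have "insert (a, b) (E1 \<union> E2) \<in> bip_graphs A B (k + 1)"
        using bip_connected_join[OF P(1-8)] sub P(1-4) by (auto simp: bip_graphs_def)
      moreover have "\<not> bip_connected A B (E1 \<union> E2)"
      proof
        assume c: "bip_connected A B (E1 \<union> E2)"
        have "saturated (E1 \<union> E2) X Y" using P(5,6) by (auto simp: saturated_def)
        then show False using bip_connectedD[OF c P(1,2)] P(3,4) by auto
      qed
      moreover have "insert (a, b) (E1 \<union> E2) - {(a, b)} = E1 \<union> E2" using ab by auto
      ultimately show "z \<in> L" by (simp add: z f_def L_def)
    next
      fix z assume "z \<in> L"
      then obtain E a b where z: "z = (E, (a, b))" and E: "E \<in> bip_graphs A B (k + 1)"
        and ab: "(a, b) \<in> E" and nc: "\<not> bip_connected A B (E - {(a, b)})"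
        by (auto simp: L_def)
      have E': "E \<subseteq> A \<times> B" "bip_connected A B E"
        "int (card E) = int (card A) + int (card B) + (k + 1) - 1"
        using E by (auto simp: bip_graphs_def)
      obtain X Y where XY: "X \<subseteq> A" "Y \<subseteq> B" "a \<in> X" "b \<in> B - Y"
        "bip_connected X Y (E \<inter> X \<times> Y)"
        "bip_connected (A - X) (B - Y) (E \<inter> (A - X) \<times> (B - Y))"
        "E - {(a, b)} = E \<inter> X \<times> Y \<union> E \<inter> (A - X) \<times> (B - Y)"
        using bip_connected_split[OF E'(1,2) ab nc] by metis
      define E1 where "E1 = E \<inter> X \<times> Y"
      define E2 where "E2 = E \<inter> (A - X) \<times> (B - Y)"
      \<comment> \<open>This is the excess of the piece containing \<open>a\<close>, solved from its
        number of edges.\<close>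
      define l where "l = int (card E1) - int (card X) - int (card Y) + 1"
      have "card (E - {(a, b)}) = card E1 + card E2"
        unfolding XY(7) E1_def E2_def using fin[OF E'(1)] by (intro card_Un_disjoint) auto
      moreover have "card E = Suc (card (E - {(a, b)}))"
        by (rule card.remove[OF fin[OF E'(1)] ab])
      ultimately have "card E = card E1 + card E2 + 1" by simp
      then have l2: "int (card E2) = int (card (A - X)) + int (card (B - Y)) + (k + 1 - l) - 1"
        using E'(3) cards[OF XY(1,2)] by (simp add: l_def)
      have fXY: "finite X" "finite Y" using XY assms finite_subset by auto
      \<comment> \<open>The edge bound for the two pieces gives \<open>0 \<le> l\<close> and
        \<open>l \<le> k + 1\<close> respectively.\<close>
      have "card X + card Y \<le> card E1 + 1"
        using card_vertices_le_edges[OF fXY _ XY(5)] by (simp add: E1_def)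
      moreover have "card (A - X) + card (B - Y) \<le> card E2 + 1"
        using card_vertices_le_edges[OF _ _ _ XY(6)] assms by (simp add: E2_def)
      ultimately have "l \<in> {0..k + 1}" using l2 by (auto simp: l_def)
      moreover have "E1 \<in> bip_graphs X Y l" using XY by (auto simp: bip_graphs_def E1_def l_def)
      moreover have "E2 \<in> bip_graphs (A - X) (B - Y) (k + 1 - l)"
        using XY l2 by (auto simp: bip_graphs_def E2_def)
      ultimately have "((X, Y, l), (E1, E2), (a, b)) \<in> T"
        using XY(1-4) by (simp add: T_def)
      moreover have "f ((X, Y, l), (E1, E2), (a, b)) = z"
        using XY(7) ab by (auto simp: f_def z E1_def E2_def)
      ultimately show "z \<in> f ` T" by (metis imageI)
    qed
  qed
  then have "card L = card T" by (rule bij_betw_same_card[symmetric])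
  also have "card T = (\<Sum>(X, Y, l)\<in>Pow A \<times> Pow B \<times> {0..k + 1}. card (bip_graphs X Y l) *
      card (bip_graphs (A - X) (B - Y) (k + 1 - l)) * (card X * card (B - Y)))"
    unfolding T_def
    by (subst card_SigmaI)
      (use assms in \<open>auto intro!: finite_cartesian_product finite_bip_graphs sum.cong
         intro: finite_subset simp: card_cartesian_product\<close>)
  also have "\<dots> = (\<Sum>X\<in>Pow A. \<Sum>Y\<in>Pow B. \<Sum>l=0..k + 1. card (bip_graphs X Y l) *
      card (bip_graphs (A - X) (B - Y) (k + 1 - l)) * (card X * card (B - Y)))"
    by (simp add: sum.cartesian_product)
  finally show ?thesis unfolding L_def .
qed

text \<open>Double counting of pairs \<open>(E, e)\<close> with \<open>e\<close> in
  \<open>E\<close>: every graph of excess \<open>k + 1\<close> has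
  \<open>card A + card B + k\<close> edges, and each edge either is a bridge or is not.\<close>

lemma bip_graphs_edge_count:
  assumes "finite A" "finite B"
  shows "(int (card A) + int (card B) + k) * int (card (bip_graphs A B (k + 1))) =
    (int (card A) * int (card B) - (int (card A) + int (card B) + k - 1)) * int (card (bip_graphs A B k)) +
    int (\<Sum>X\<in>Pow A. \<Sum>Y\<in>Pow B. \<Sum>l=0..k + 1. card (bip_graphs X Y l) *
      card (bip_graphs (A - X) (B - Y) (k + 1 - l)) * (card X * card (B - Y)))"
proof -
  define L where "L = (SIGMA E:bip_graphs A B (k + 1). E)"
  define L1 where "L1 = {(E, e). E \<in> bip_graphs A B (k + 1) \<and> e \<in> E \<and> bip_connected A B (E - {e})}"
  define L2 where "L2 = {(E, e). E \<in> bip_graphs A B (k + 1) \<and> e \<in> E \<and> \<not> bip_connected A B (E - {e})}"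
  have fin: "finite E" if "E \<in> bip_graphs A B (k + 1)" for E
    using assms that finite_subset[of E "A \<times> B"] by (auto simp: bip_graphs_def)
  have "int (card L) = (int (card A) + int (card B) + k) * int (card (bip_graphs A B (k + 1)))"
    unfolding L_def
  proof (rule int_card_SIGMA)
    show "int (card E) = int (card A) + int (card B) + k" if "E \<in> bip_graphs A B (k + 1)" for E
      using that by (simp add: bip_graphs_def)
  qed (use assms fin finite_bip_graphs in auto)
  moreover have "finite L"
    unfolding L_def using assms fin by (intro finite_SigmaI finite_bip_graphs)
  moreover have "L = L1 \<union> L2" "L1 \<inter> L2 = {}" by (auto simp: L_def L1_def L2_def)
  ultimately have "(int (card A) + int (card B) + k) * int (card (bip_graphs A B (k + 1))) =
      int (card L1) + int (card L2)"
    by (metis card_Un_disjoint finite_Un of_nat_add)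
  then show ?thesis
    unfolding L1_def L2_def bip_graphs_removable_edges[OF assms] bip_graphs_bridges[OF assms] .
qed

section \<open>Invariance under relabelling\<close>

text \<open>Relabelling acts injectively on edge sets, and a cut of the image pulls back to a cut of
  \<open>E\<close>. An inequality suffices, as the inverse bijections provide the opposite
  one.\<close>

lemma card_bip_graphs_le:
  assumes f: "bij_betw f A A'" and g: "bij_betw g B B'" and fin: "finite A" "finite B"
  shows "card (bip_graphs A B k) \<le> card (bip_graphs A' B' k)"
proof (rule card_inj_on_le)
  have inj: "inj_on (map_prod f g) (A \<times> B)"
    using f g by (intro map_prod_inj_on) (auto simp: bij_betw_def)
  show "inj_on ((`) (map_prod f g)) (bip_graphs A B k)"
    by (rule inj_on_subset[OF inj_on_image_Pow[OF inj]]) (auto simp: bip_graphs_def)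
  have fin': "finite A'" "finite B'" using f g fin by (auto simp: bij_betw_finite)
  then show "finite (bip_graphs A' B' k)" by (rule finite_bip_graphs)
  show "(`) (map_prod f g) ` bip_graphs A B k \<subseteq> bip_graphs A' B' k"
  proof clarify
    fix E assume "E \<in> bip_graphs A B k"
    then have E: "E \<subseteq> A \<times> B" and c: "bip_connected A B E"
      and k: "int (card E) = int (card A) + int (card B) + k - 1"
      by (auto simp: bip_graphs_def)
    have "bip_connected A' B' (map_prod f g ` E)"
      unfolding bip_connected_def
    proof (intro conjI allI impI)
      show "A' \<noteq> {} \<or> B' \<noteq> {}"
        using c f g by (auto simp: bip_connected_def bij_betw_def)
      fix X Y assume XY: "X \<subseteq> A' \<and> Y \<subseteq> B' \<and> saturated (map_prod f g ` E) X Y"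
      then have im: "f ` {a \<in> A. f a \<in> X} = X" "g ` {b \<in> B. g b \<in> Y} = Y"
        using f g by (auto simp: bij_betw_def)
      have "saturated E {a \<in> A. f a \<in> X} {b \<in> B. g b \<in> Y}"
        using XY E by (force simp: saturated_def)
      then have "{a \<in> A. f a \<in> X} = {} \<and> {b \<in> B. g b \<in> Y} = {} \<or>
          {a \<in> A. f a \<in> X} = A \<and> {b \<in> B. g b \<in> Y} = B"
        by (intro bip_connectedD[OF c]) auto
      then show "X = {} \<and> Y = {} \<or> X = A' \<and> Y = B'"
      proof
        assume "{a \<in> A. f a \<in> X} = {} \<and> {b \<in> B. g b \<in> Y} = {}"
        then have "X = {} \<and> Y = {}" using im by (metis image_empty)
        then show ?thesis ..
      next
        assume "{a \<in> A. f a \<in> X} = A \<and> {b \<in> B. g b \<in> Y} = B"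
        then have "X = A' \<and> Y = B'" using im f g by (simp add: bij_betw_def)
        then show ?thesis ..
      qed
    qed
    moreover have "card (map_prod f g ` E) = card E"
      by (rule card_image) (rule inj_on_subset[OF inj E])
    moreover have "map_prod f g ` E \<subseteq> A' \<times> B'"
      using E f g by (auto simp: bij_betw_def)
    ultimately show "map_prod f g ` E \<in> bip_graphs A' B' k"
      using k bij_betw_same_card[OF f] bij_betw_same_card[OF g] by (simp add: bip_graphs_def)
  qed
qed

definition bip_count :: "nat \<Rightarrow> nat \<Rightarrow> int \<Rightarrow> nat" where
  "bip_count r s k = card (bip_graphs {..<r} {..<s} k)"

lemma card_bip_graphs:
  assumes "finite A" "finite B"
  shows "card (bip_graphs A B k) = bip_count (card A) (card B) k"
proof -
  obtain f g where fg: "bij_betw f A {..<card A}" "bij_betw g B {..<card B}"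
    using assms by (metis finite_same_card_bij finite_lessThan card_lessThan)
  show ?thesis
    unfolding bip_count_def
    using card_bip_graphs_le[OF fg assms]
      card_bip_graphs_le[OF fg[THEN bij_betw_inv_into]] by (simp add: le_antisym)
qed

lemma bip_count_negative: "k < 0 \<Longrightarrow> bip_count r s k = 0"
  by (simp add: bip_count_def bip_graphs_negative)

lemma sum_Pow_card:
  fixes h :: "nat \<Rightarrow> 'b::comm_semiring_1"
  assumes "finite A"
  shows "(\<Sum>X\<in>Pow A. h (card X)) = (\<Sum>i=0..card A. of_nat (card A choose i) * h i)"
proof -
  have "(\<Sum>X\<in>Pow A. h (card X)) = (\<Sum>i=0..card A. \<Sum>X\<in>{X \<in> Pow A. card X = i}. h (card X))"
    using assms by (intro sum.group[symmetric]) (auto intro: card_mono)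
  also have "\<dots> = (\<Sum>i=0..card A. of_nat (card A choose i) * h i)"
    using n_subsets[OF assms] by (intro sum.cong) (simp_all add: Pow_def)
  finally show ?thesis .
qed

text \<open>Every summand depends on \<open>X\<close> and \<open>Y\<close> through their sizes only,
  so grouping by size produces the binomials. Over the integers the difference is a true
  subtraction; it can be negative only when there is no graph of excess \<open>k\<close>.\<close>

lemma bip_count_recursion:
  "(int r + int s + k) * int (bip_count r s (k + 1)) =
    (int r * int s - (int r + int s + k - 1)) * int (bip_count r s k) +
    (\<Sum>i=0..r. \<Sum>j=0..s. \<Sum>l=0..k + 1. int (r choose i) * int (s choose j) *
      (int (bip_count i j l) * int (bip_count (r - i) (s - j) (k + 1 - l)) * (int i * int (s - j))))"
proof -
  let ?h = "\<lambda>i j. \<Sum>l=0..k + 1. int (bip_count i j l) *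
      int (bip_count (r - i) (s - j) (k + 1 - l)) * (int i * int (s - j))"
  have "int (\<Sum>X\<in>Pow {..<r}. \<Sum>Y\<in>Pow {..<s}. \<Sum>l=0..k + 1. card (bip_graphs X Y l) *
      card (bip_graphs ({..<r} - X) ({..<s} - Y) (k + 1 - l)) * (card X * card ({..<s} - Y))) =
    (\<Sum>X\<in>Pow {..<r}. \<Sum>Y\<in>Pow {..<s}. ?h (card X) (card Y))"
    unfolding of_nat_sum
  proof (intro sum.cong refl)
    fix X Y l assume "X \<in> Pow {..<r}" "Y \<in> Pow {..<s}"
    moreover from this have "finite X" "finite Y" by (auto intro: finite_subset)
    ultimately show "int (card (bip_graphs X Y l) *
        card (bip_graphs ({..<r} - X) ({..<s} - Y) (k + 1 - l)) * (card X * card ({..<s} - Y))) =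
      int (bip_count (card X) (card Y) l) *
        int (bip_count (r - card X) (s - card Y) (k + 1 - l)) * (int (card X) * int (s - card Y))"
      by (simp add: card_bip_graphs card_Diff_subset)
  qed
  also have "\<dots> = (\<Sum>X\<in>Pow {..<r}. \<Sum>j=0..s. int (s choose j) * ?h (card X) j)"
    by (intro sum.cong refl sum_Pow_card[of "{..<s}" "?h (card X)" for X, unfolded card_lessThan, OF finite_lessThan])
  also have "\<dots> = (\<Sum>i=0..r. int (r choose i) * (\<Sum>j=0..s. int (s choose j) * ?h i j))"
    by (rule sum_Pow_card[of "{..<r}" "\<lambda>i. \<Sum>j=0..s. int (s choose j) * ?h i j",
        unfolded card_lessThan, OF finite_lessThan])
  also have "\<dots> = (\<Sum>i=0..r. \<Sum>j=0..s. \<Sum>l=0..k + 1. int (r choose i) * int (s choose j) *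
      (int (bip_count i j l) * int (bip_count (r - i) (s - j) (k + 1 - l)) * (int i * int (s - j))))"
    by (simp add: sum_distrib_left mult.assoc)
  finally show ?thesis
    using bip_graphs_edge_count[of "{..<r}" "{..<s}" k] by (simp add: bip_count_def)
qed

subsection \<open>Correspondence with pair graphs\<close>

definition pair_graph_of :: "nat \<Rightarrow> nat \<Rightarrow> (nat \<times> nat) set \<Rightarrow> (nat + nat) pair_pre_digraph" where
  "pair_graph_of r s E = \<lparr> pverts = left_part r \<union> right_part s,
     parcs = (\<lambda>(a, b). (Inl a, Inr b)) ` E \<union> (\<lambda>(a, b). (Inr b, Inl a)) ` E \<rparr>"

lemma pair_graph_of_simps [simp]:
  "pverts (pair_graph_of r s E) = left_part r \<union> right_part s"
  "(Inl a, Inr b) \<in> parcs (pair_graph_of r s E) \<longleftrightarrow> (a, b) \<in> E"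
  "(Inr b, Inl a) \<in> parcs (pair_graph_of r s E) \<longleftrightarrow> (a, b) \<in> E"
  "(Inl a, Inl a') \<notin> parcs (pair_graph_of r s E)"
  "(Inr b, Inr b') \<notin> parcs (pair_graph_of r s E)"
  by (auto simp: pair_graph_of_def)

text \<open>Saturated pairs are exactly the vertex sets closed under arcs. If paths exist, a
  nonempty such set contains everything reachable from one of its points; conversely, the set of
  vertices reachable from \<open>u\<close> is itself saturated.\<close>

lemma connected_pair_graph_of_iff:
  assumes E: "E \<subseteq> {..<r} \<times> {..<s}"
  shows "Digraph_Component.connected (with_proj (pair_graph_of r s E)) \<longleftrightarrow>
    bip_connected {..<r} {..<s} E"
proof -
  define V where "V = left_part r \<union> right_part s"
  define R where "R = parcs (pair_graph_of r s E)"
  have V: "Inl a \<in> V \<longleftrightarrow> a < r" "Inr b \<in> V \<longleftrightarrow> b < s" for a b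
    by (auto simp: V_def left_part_def right_part_def)
  have R: "(Inl a, Inr b) \<in> R \<longleftrightarrow> (a, b) \<in> E" "(Inr b, Inl a) \<in> R \<longleftrightarrow> (a, b) \<in> E"
    "(Inl a, Inl a') \<notin> R" "(Inr b, Inr b') \<notin> R" for a a' b b'
    by (simp_all add: R_def)
  \<comment> \<open>Both orientations of each edge are present, so reachability in the symmetric
    closure is reachability along \<open>R\<close>.\<close>
  have "R\<^sup>s = R"
    by (auto simp: symcl_def R_def pair_graph_of_def)
  then have conv: "Digraph_Component.connected (with_proj (pair_graph_of r s E)) \<longleftrightarrow>
      V \<noteq> {} \<and> (\<forall>u\<in>V. \<forall>v\<in>V. (u, v) \<in> rtrancl_on V R)"
    by (simp add: connected_conv V_def R_def)
  have ne: "V \<noteq> {} \<longleftrightarrow> {..<r} \<noteq> {} \<or> {..<s} \<noteq> {}"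
    by (auto simp: V_def left_part_def right_part_def)
  show ?thesis
  proof
    assume "Digraph_Component.connected (with_proj (pair_graph_of r s E))"
    then have c: "V \<noteq> {}" "\<And>u v. u \<in> V \<Longrightarrow> v \<in> V \<Longrightarrow> (u, v) \<in> rtrancl_on V R" using conv by auto
    show "bip_connected {..<r} {..<s} E"
      unfolding bip_connected_def
    proof (intro conjI allI impI)
      show "{..<r} \<noteq> {} \<or> {..<s} \<noteq> {}" using c ne by simp
      fix X Y assume XY: "X \<subseteq> {..<r} \<and> Y \<subseteq> {..<s} \<and> saturated E X Y"
      have reach: "v \<in> Inl ` X \<union> Inr ` Y" if "(u, v) \<in> rtrancl_on V R" "u \<in> Inl ` X \<union> Inr ` Y" for u v
        using that
      proof (induction rule: rtrancl_on_induct)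
        case (step y z)
        then show ?case using XY R
          by (cases y; cases z) (auto simp: saturated_def)
      qed
      show "X = {} \<and> Y = {} \<or> X = {..<r} \<and> Y = {..<s}"
      proof (cases "X = {} \<and> Y = {}")
        case False
        then obtain u where u: "u \<in> Inl ` X \<union> Inr ` Y" by blast
        then have "u \<in> V" using XY V by auto
        then have all: "v \<in> Inl ` X \<union> Inr ` Y" if "v \<in> V" for v
          using c(2) reach u that by blast
        have "a \<in> X" if "a < r" for a using all[of "Inl a"] that V by auto
        moreover have "b \<in> Y" if "b < s" for b using all[of "Inr b"] that V by auto
        ultimately show ?thesis using XY by auto
      qed simp
    qed
  next
    assume c: "bip_connected {..<r} {..<s} E"
    have "(u, v) \<in> rtrancl_on V R" if u: "u \<in> V" and v: "v \<in> V" for u v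
    proof -
      define X where "X = {a \<in> {..<r}. (u, Inl a) \<in> rtrancl_on V R}"
      define Y where "Y = {b \<in> {..<s}. (u, Inr b) \<in> rtrancl_on V R}"
      have "saturated E X Y"
        unfolding saturated_def
      proof (intro allI impI)
        fix a b assume ab: "(a, b) \<in> E"
        then have "a < r" "b < s" using E by auto
        then show "a \<in> X \<longleftrightarrow> b \<in> Y"
          using ab R V by (auto simp: X_def Y_def intro: rtrancl_on_into_rtrancl_on)
      qed
      moreover have "\<not> (X = {} \<and> Y = {})"
        using u V by (cases u) (auto simp: X_def Y_def)
      ultimately have "X = {..<r} \<and> Y = {..<s}"
        using bip_connectedD[OF c, of X Y] by (auto simp: X_def Y_def)
      then show ?thesis using v V by (cases v) (auto simp: X_def Y_def)
    qed
    then show "Digraph_Component.connected (with_proj (pair_graph_of r s E))"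
      using c ne conv by (simp add: bip_connected_def)
  qed
qed

lemma card_edges_pair_graph_of: "card (edges (pair_graph_of r s E)) = card E"
proof -
  have "edges (pair_graph_of r s E) = (\<lambda>(a, b). {Inl a, Inr b}) ` E"
  proof (intro equalityI subsetI)
    fix x assume "x \<in> (\<lambda>(a, b). {Inl a, Inr b}) ` E"
    then obtain a b where "x = {Inl a, Inr b}" "(Inl a, Inr b) \<in> parcs (pair_graph_of r s E)"
      by auto
    then show "x \<in> edges (pair_graph_of r s E)" unfolding edges_def by blast
  qed (auto simp: edges_def pair_graph_of_def insert_commute)
  moreover have "inj_on (\<lambda>(a, b). {Inl a, Inr b}) E"
    by (auto simp: inj_on_def doubleton_eq_iff)
  ultimately show ?thesis by (simp add: card_image)
qed

lemma pair_graph_pair_graph_of: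
  assumes "E \<subseteq> {..<r} \<times> {..<s}"
  shows "pair_graph (pair_graph_of r s E)"
proof -
  have "finite E" using assms finite_subset by blast
  then show ?thesis
    using assms
    by unfold_locales
      (auto simp: pair_graph_of_def left_part_def right_part_def symmetric_def sym_def)
qed

text \<open>By symmetry the arcs from left to right determine all others, and no arc stays within
  one part.\<close>

lemma bip_graph_eq_pair_graph_of:
  assumes "pair_graph G" "pverts G = left_part r \<union> right_part s"
    and "parcs G \<subseteq> left_part r \<times> right_part s \<union> right_part s \<times> left_part r"
  obtains E where "E \<subseteq> {..<r} \<times> {..<s}" "G = pair_graph_of r s E"
proof
  interpret pair_graph G by fact
  have sym: "(u, v) \<in> parcs G \<longleftrightarrow> (v, u) \<in> parcs G" for u v
    using pair_sym_arcs by (auto simp: symmetric_def sym_def)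
  define E where "E = {(a, b). (Inl a, Inr b) \<in> parcs G}"
  show "{(a, b). (Inl a, Inr b) \<in> parcs G} \<subseteq> {..<r} \<times> {..<s}"
    using assms(3) by (auto simp: left_part_def right_part_def)
  have "(u, v) \<in> parcs G \<longleftrightarrow> (u, v) \<in> parcs (pair_graph_of r s E)" for u v
    using assms(3) sym by (cases u; cases v) (auto simp: E_def left_part_def right_part_def)
  then have "parcs G = parcs (pair_graph_of r s E)" by auto
  then show "G = pair_graph_of r s {(a, b). (Inl a, Inr b) \<in> parcs G}"
    unfolding E_def[symmetric] using assms(2) by (intro pair_pre_digraph.equality) auto
qed

text \<open>Only the empty edge set is available, and it is connected just for a single vertex,
  where the excess is \<open>0\<close>. The stipulated values of \<open>N_bi\<close> are thus what
  the general count gives.\<close>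

lemma bip_count_degenerate:
  assumes "r * s = 0"
  shows "bip_count r s k = (if k = 0 \<and> (r, s) \<in> {(1, 0), (0, 1)} then 1 else 0)"
proof -
  have "bip_connected {..<r} {..<s} {} \<longleftrightarrow> r + s = 1"
  proof
    assume "r + s = 1"
    then consider "r = 1" "s = 0" | "r = 0" "s = 1" by linarith
    then show "bip_connected {..<r} {..<s} {}"
      by cases (simp_all add: bip_connected_def lessThan_Suc subset_singleton_iff)
  qed (use bip_connected_empty_edges[of "{..<r}" "{..<s}"] in simp)
  moreover have "{..<r} \<times> {..<s} = {}" using assms by auto
  ultimately have "bip_graphs {..<r} {..<s} k = (if r + s = 1 \<and> k = 0 then {{}} else {})"
    by (auto simp: bip_graphs_def)
  moreover have "r + s = 1 \<longleftrightarrow> (r, s) \<in> {(1, 0), (0, 1)}" by auto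
  ultimately show ?thesis by (simp add: bip_count_def)
qed

lemma N_bi_eq_bip_count: "N_bi r s k = bip_count r s k"
proof (cases "r * s = 0")
  case True
  then show ?thesis using bip_count_degenerate by (simp add: N_bi_def)
next
  case False
  let ?S = "{G \<in> connected_bipartite_graphs r s. int (card (edges G)) = int r + int s + k - 1}"
  have "bij_betw (pair_graph_of r s) (bip_graphs {..<r} {..<s} k) ?S"
    unfolding bij_betw_def
  proof (intro conjI equalityI subsetI)
    show "inj_on (pair_graph_of r s) (bip_graphs {..<r} {..<s} k)"
    proof (rule inj_onI)
      fix E E' assume "pair_graph_of r s E = pair_graph_of r s E'"
      then have "(a, b) \<in> E \<longleftrightarrow> (a, b) \<in> E'" for a b by (metis pair_graph_of_simps(2))
      then show "E = E'" by auto
    qed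
  next
    fix G assume "G \<in> pair_graph_of r s ` bip_graphs {..<r} {..<s} k"
    then obtain E where E: "E \<subseteq> {..<r} \<times> {..<s}" "bip_connected {..<r} {..<s} E"
      "int (card E) = int r + int s + k - 1" and G: "G = pair_graph_of r s E"
      by (auto simp: bip_graphs_def)
    have "parcs G \<subseteq> left_part r \<times> right_part s \<union> right_part s \<times> left_part r"
      using E(1) by (auto simp: G pair_graph_of_def left_part_def right_part_def)
    then show "G \<in> ?S"
      using E pair_graph_pair_graph_of[OF E(1)] connected_pair_graph_of_iff[OF E(1)]
      by (simp add: G connected_bipartite_graphs_def card_edges_pair_graph_of)
  next
    fix G assume G: "G \<in> ?S"
    then obtain E where E: "E \<subseteq> {..<r} \<times> {..<s}" and eq: "G = pair_graph_of r s E"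
      using bip_graph_eq_pair_graph_of[of G r s] by (auto simp: connected_bipartite_graphs_def)
    then have "E \<in> bip_graphs {..<r} {..<s} k"
      using G connected_pair_graph_of_iff[OF E]
      by (simp add: bip_graphs_def connected_bipartite_graphs_def card_edges_pair_graph_of)
    then show "G \<in> pair_graph_of r s ` bip_graphs {..<r} {..<s} k" using eq by blast
  qed
  then have "card ?S = bip_count r s k"
    unfolding bip_count_def by (rule bij_betw_same_card[symmetric])
  then show ?thesis using False by (simp add: N_bi_def)
qed

subsection \<open>Coefficients\<close>

unbundle fps_syntax

text \<open>One formula covers negative \<open>k\<close> too: there the count vanishes, in agreement
  with \<open>F k = 0\<close>.\<close>

lemma F_nth: "F k $ r $ s = of_nat (bip_count r s k) / (fact r * fact s)"
  by (simp add: F_def N_bi_eq_bip_count bip_count_negative)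

lemma D_x_nth: "D_x f $ r $ s = of_nat r * f $ r $ s"
  by (cases r) (simp_all add: D_x_def del: of_nat_Suc)

lemma D_y_nth: "D_y f $ r $ s = of_nat s * f $ r $ s"
  by (cases s) (simp_all add: D_y_def del: of_nat_Suc)

text \<open>The operators \<open>D_x\<close> and \<open>D_y\<close> multiply the coefficient of
  \<open>x^r y^s\<close> by \<open>r\<close> and \<open>s\<close>, so that coefficient of the
  equation is \<open>bip_count_recursion\<close> divided by \<open>r! s!\<close>.\<close>

theorem proposition2p2:
  fixes k :: int
  assumes "k \<ge> -1"
  shows "D_x (F (k + 1)) + D_y (F (k + 1)) + of_int k * F (k + 1) =
    D_x (D_y (F k)) - D_x (F k) - D_y (F k) + of_int (1 - k) * F k +
    (\<Sum>l = 0..k + 1. D_x (F l) * D_y (F (k + 1 - l)))"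
proof (intro fps_ext)
  fix r s
  let ?c = "\<lambda>r s k. of_nat (bip_count r s k) :: rat"
  let ?d = "fact r * fact s :: rat"
  let ?P = "\<Sum>i=0..r. \<Sum>j=0..s. \<Sum>l=0..k + 1. of_nat (r choose i) * of_nat (s choose j) *
      (?c i j l * ?c (r - i) (s - j) (k + 1 - l) * (of_nat i * of_nat (s - j)))"
  have "(\<Sum>l = 0..k + 1. D_x (F l) * D_y (F (k + 1 - l))) $ r $ s =
    (\<Sum>l = 0..k + 1. \<Sum>i=0..r. \<Sum>j=0..s. D_x (F l) $ i $ j * D_y (F (k + 1 - l)) $ (r - i) $ (s - j))"
    by (simp add: fps_sum_nth fps_mult_nth)
  \<comment> \<open>Two exchanges move the sum over \<open>l\<close> innermost, the order used in
    the recursion.\<close>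
  also have "\<dots> = (\<Sum>i=0..r. \<Sum>l = 0..k + 1. \<Sum>j=0..s. D_x (F l) $ i $ j * D_y (F (k + 1 - l)) $ (r - i) $ (s - j))"
    by (rule sum.swap)
  also have "\<dots> = (\<Sum>i=0..r. \<Sum>j=0..s. \<Sum>l = 0..k + 1. D_x (F l) $ i $ j * D_y (F (k + 1 - l)) $ (r - i) $ (s - j))"
    by (intro sum.cong refl sum.swap)
  also have "\<dots> = ?P / ?d"
    unfolding sum_divide_distrib
  proof (intro sum.cong refl)
    fix i j l assume "i \<in> {0..r}" "j \<in> {0..s}"
    \<comment> \<open>Written with factorials, the binomials divided by \<open>r! s!\<close> become
      exactly the denominators of the coefficients of the two factors.\<close>
    then have b: "of_nat (r choose i) = (fact r / (fact i * fact (r - i)) :: rat)"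
      "of_nat (s choose j) = (fact s / (fact j * fact (s - j)) :: rat)"
      by (simp_all add: binomial_fact)
    show "D_x (F l) $ i $ j * D_y (F (k + 1 - l)) $ (r - i) $ (s - j) =
      of_nat (r choose i) * of_nat (s choose j) *
      (?c i j l * ?c (r - i) (s - j) (k + 1 - l) * (of_nat i * of_nat (s - j))) / ?d"
      unfolding D_x_nth D_y_nth F_nth b by (simp add: mult_ac del: of_nat_diff)
  qed
  finally have P: "(\<Sum>l = 0..k + 1. D_x (F l) * D_y (F (k + 1 - l))) $ r $ s = ?P / ?d" .
  \<comment> \<open>The integer recursion is carried over to the rationals as a whole, so that its
    subtraction keeps its meaning.\<close>
  have "of_int ((int r + int s + k) * int (bip_count r s (k + 1))) =
    (of_int ((int r * int s - (int r + int s + k - 1)) * int (bip_count r s k) +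
    (\<Sum>i=0..r. \<Sum>j=0..s. \<Sum>l=0..k + 1. int (r choose i) * int (s choose j) *
      (int (bip_count i j l) * int (bip_count (r - i) (s - j) (k + 1 - l)) * (int i * int (s - j))))) :: rat)"
    by (simp only: bip_count_recursion)
  then have rec: "(of_nat r + of_nat s + of_int k) * ?c r s (k + 1) =
    (of_nat r * of_nat s - (of_nat r + of_nat s + of_int k - 1)) * ?c r s k + ?P"
    by (simp only: of_int_mult of_int_add of_int_diff of_int_sum of_int_of_nat_eq of_int_1)
  have "(D_x (F (k + 1)) + D_y (F (k + 1)) + of_int k * F (k + 1)) $ r $ s =
    (of_nat r + of_nat s + of_int k) * ?c r s (k + 1) / ?d"
    by (simp only: fps_add_nth fps_mult_of_int_nth D_x_nth D_y_nth F_nth)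
      (simp add: algebra_simps add_divide_distrib)
  also have "\<dots> = (of_nat r * of_nat s - (of_nat r + of_nat s + of_int k - 1)) * (?c r s k / ?d) + ?P / ?d"
    unfolding rec by (simp add: add_divide_distrib)
  also have "\<dots> = (D_x (D_y (F k)) - D_x (F k) - D_y (F k) + of_int (1 - k) * F k +
    (\<Sum>l = 0..k + 1. D_x (F l) * D_y (F (k + 1 - l)))) $ r $ s"
    by (simp only: fps_add_nth fps_sub_nth fps_mult_of_int_nth D_x_nth D_y_nth F_nth P)
      (simp add: algebra_simps add_divide_distrib diff_divide_distrib)
  finally show "(D_x (F (k + 1)) + D_y (F (k + 1)) + of_int k * F (k + 1)) $ r $ s =
    (D_x (D_y (F k)) - D_x (F k) - D_y (F k) + of_int (1 - k) * F k +
    (\<Sum>l = 0..k + 1. D_x (F l) * D_y (F (k + 1 - l)))) $ r $ s" .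
qed

end
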